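(* Let $\kappa>0$, $\lambda>0$, $\lambda<1+\kappa$, and consider the history-dependent Parrondo games $A$ and $B$ with parameters $\kappa,\lambda$ and with bias parameter absent (i.e. equal to $0$). Let $K:=\{k/l:k,l=1,2,\ldots,9\}$. Suppose that one of the following holds: (a) $\kappa=\lambda>0$; (b) $\kappa>0$ and $\lambda=1$; (c) $\kappa,\lambda\in K$, $\lambda<1+\kappa$, $\kappa\ne\lambda$, $\lambda\ne1$, $\beta^2+4\alpha^3\ne0$, and $\kappa\lambda\ne1$. Then for every pair of positive integers $r$ and $s$, the asymptotic mean profit per game played $\mu_{[r,s]}(0)$ of the pattern $[r,s]$ satisfies: $\mu_{[r,s]}(0)>0$ if $\kappa<\lambda<1$ or $\kappa>\lambda>1$; $\mu_{[r,s]}(0)=0$ if $\kappa=\lambda$ or $\lambda=1$; and $\mu_{[r,s]}(0)<0$ if $\lambda<\min(\kappa,1)$ or $\lambda>\max(\kappa,1)$.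
   Context: For $p_0,p_1,p_2,p_3\in(0,1)$ let, on state space $\Sigma=\{0,1,2,3\}$, $$\boldsymbol{P}(p_0,p_1,p_2,p_3):=\begin{pmatrix}1-p_0&p_0&0&0\\0&0&1-p_1&p_1\\1-p_2&p_2&0&0\\0&0&1-p_3&p_3\end{pmatrix},\qquad (w(i,j))_{i,j\in\Sigma}:=\begin{pmatrix}-1&1&0&0\\0&0&-1&1\\-1&1&0&0\\0&0&-1&1\end{pmatrix},$$ where $w(i,j)$ is the payoff (profit) of a transition from $i$ to $j$. (States $0,1,2,3$, in binary $00,01,10,11$, represent loss-loss, loss-win, win-loss, win-win for the two preceding games, the more recent result listed second.) With bias parameter $0$: game $A$ has transition matrix $\boldsymbol{P}_A:=\boldsymbol{P}(\tfrac12,\tfrac12,\tfrac12,\tfrac12)$ and game $B$ has transition matrix $\boldsymbol{P}_B:=\boldsymbol{P}(p_0,p_1,p_2,p_3)$ with $p_0:=\frac1{1+\kappa}$, $p_1=p_2:=\frac{\lambda}{1+\lambda}$, $p_3:=1-\frac{\lambda}{1+\kappa}$. The pattern $[r,s]$ denotes $r$ plays of game $A$ followed by $s$ plays of game $B$, repeated ad infinitum. With $\boldsymbol{\pi}$ the unique stationary distribution of $\boldsymbol{P}_A^r\boldsymbol{P}_B^s$, $$\mu_{[r,s]}(0):=\frac1{r+s}\Big(\sum_{u=0}^{r-1}\sum_{i,j}(\boldsymbol{\pi}\boldsymbol{P}_A^u)_i(\boldsymbol{P}_A)_{ij}w(i,j)+\sum_{v=0}^{s-1}\sum_{i,j}(\boldsymbol{\pi}\boldsymbol{P}_A^r\boldsymbol{P}_B^v)_i(\boldsymbol{P}_B)_{ij}w(i,j)\Big).$$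 Finally, $$\alpha:=(\lambda-\kappa)(\kappa+5\lambda+5\kappa\lambda+\lambda^2+\kappa\lambda^2-\lambda^3),$$ $$\begin{aligned}\beta:=(1+\lambda)(&27+54\kappa-27\lambda+27\kappa^2-54\kappa\lambda-27\lambda^2+2\kappa^3-42\kappa^2\lambda-30\kappa\lambda^2+16\lambda^3\\&-14\kappa^3\lambda+6\kappa^2\lambda^2+30\kappa\lambda^3+5\lambda^4+2\kappa^3\lambda^2+21\kappa^2\lambda^3+6\kappa\lambda^4-2\lambda^5).\end{aligned}$$ *)

theory Defs
  imports Complex_Main "Jordan_Normal_Form.Matrix"
begin

definition transition_mat :: "real \<Rightarrow> real \<Rightarrow> real \<Rightarrow> real \<Rightarrow> real mat" where
  "transition_mat p0 p1 p2 p3 = mat_of_rows_list 4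
     [[1 - p0, p0, 0, 0],
      [0, 0, 1 - p1, p1],
      [1 - p2, p2, 0, 0],
      [0, 0, 1 - p3, p3]]"

definition payoff_mat :: "real mat" where
  "payoff_mat = mat_of_rows_list 4
     [[-1, 1, 0, 0],
      [0, 0, -1, 1],
      [-1, 1, 0, 0],
      [0, 0, -1, 1]]"

definition game_A :: "real mat" where
  "game_A = transition_mat (1/2) (1/2) (1/2) (1/2)"

definition game_B :: "real \<Rightarrow> real \<Rightarrow> real mat" where
  "game_B kappa lambda = transition_mat
     (1 / (1 + kappa)) (lambda / (1 + lambda)) (lambda / (1 + lambda)) (1 - lambda / (1 + kappa))"

text \<open>Distributions are row vectors acting on transition matrices from the left.\<close>

definition row_vec_mult :: "real vec \<Rightarrow> real mat \<Rightarrow> real vec" where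
  "row_vec_mult v M = vec (dim_col M) (\<lambda>j. v \<bullet> col M j)"

definition is_stationary_distribution :: "real mat \<Rightarrow> real vec \<Rightarrow> bool" where
  "is_stationary_distribution M v \<longleftrightarrow>
     v \<in> carrier_vec (dim_row M) \<and>
     (\<forall>i<dim_row M. 0 \<le> v $ i) \<and>
     (\<Sum>i<dim_row M. v $ i) = 1 \<and>
     row_vec_mult v M = v"

definition stationary_distribution :: "real mat \<Rightarrow> real vec" where
  "stationary_distribution M = (THE v. is_stationary_distribution M v)"

definition expected_payoff :: "real vec \<Rightarrow> real mat \<Rightarrow> real" where
  "expected_payoff v M = (\<Sum>i<4. \<Sum>j<4. v $ i * M $$ (i, j) * payoff_mat $$ (i, j))"

definition pattern_stationary :: "real \<Rightarrow> real \<Rightarrow> nat \<Rightarrow> nat \<Rightarrow> real vec" where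
  "pattern_stationary kappa lambda r s =
     stationary_distribution ((game_A ^\<^sub>m r) * (game_B kappa lambda ^\<^sub>m s))"

text \<open>The mean profit is that of the unbiased games, i.e. the bias parameter is \<open>0\<close>.\<close>

definition mean_profit :: "real \<Rightarrow> real \<Rightarrow> nat \<Rightarrow> nat \<Rightarrow> real" where
  "mean_profit kappa lambda r s =
     1 / (real r + real s) *
       ((\<Sum>u<r. expected_payoff
           (row_vec_mult (pattern_stationary kappa lambda r s) (game_A ^\<^sub>m u)) game_A) +
        (\<Sum>v<s. expected_payoff
           (row_vec_mult (pattern_stationary kappa lambda r s)
             ((game_A ^\<^sub>m r) * (game_B kappa lambda ^\<^sub>m v))) (game_B kappa lambda)))"

definition ratio_grid :: "real set" where
  "ratio_grid = {real k / real l | k l. k \<in> {1..9} \<and> l \<in> {1..9}}"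

definition alpha :: "real \<Rightarrow> real \<Rightarrow> real" where
  "alpha kappa lambda = (lambda - kappa) * (kappa + 5*lambda + 5*kappa*lambda + lambda^2 + kappa*lambda^2 - lambda^3)"

definition beta :: "real \<Rightarrow> real \<Rightarrow> real" where
  "beta kappa lambda = (1 + lambda) *
     (27 + 54*kappa - 27*lambda + 27*kappa^2 - 54*kappa*lambda - 27*lambda^2
      + 2*kappa^3 - 42*kappa^2*lambda - 30*kappa*lambda^2 + 16*lambda^3
      - 14*kappa^3*lambda + 6*kappa^2*lambda^2 + 30*kappa*lambda^3 + 5*lambda^4
      + 2*kappa^3*lambda^2 + 21*kappa^2*lambda^3 + 6*kappa*lambda^4 - 2*lambda^5)"

end

theory Submission
  imports Defs
begin

text \<open>Count a win as 1 and a loss as -1. With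
  \<open>c = (kappa - lambda) / (2 * (1 + kappa))\<close> and \<open>y = (1 - lambda) / (1 + lambda)\<close>, the expected
  results \<open>m t\<close> of successive plays of \<open>B\<close> satisfy a homogeneous third-order recurrence, with
  coefficients \<open>2 * c\<close>, \<open>c * (1 - c) * (1 - y^2)\<close> and \<open>eta = y^2 * (1 - c)^2 - c^2\<close>, whose
  characteristic roots are the eigenvalues of \<open>B\<close> other than 1.
  Plays of \<open>A\<close> have mean profit zero. Two or more of them make the state uniform, while a single one
  remembers only the balance \<open>q\<close> of the preceding result. Hence the profit of \<open>[r, s]\<close> is \<open>- c * y\<close>
  times a factor built from the fundamental solution of the recurrence and its partial sums, and
  \<open>- c * y\<close> has the sign of \<open>(lambda - kappa) * (1 - lambda)\<close>. The factor is positive.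

  For \<open>c \<ge> 0\<close> the fundamental solution is itself nonnegative. For \<open>c = -b < 0\<close> the partial sums \<open>H\<close>
  satisfy \<open>H (n + 1) \<ge> (1 - 2 * b) * H n\<close>, which uses that the winning probabilities lie in
  \<open>(0, 1)\<close> in the form \<open>\<bar>y\<bar> * (1 + 2 * b) < 1 - 2 * b\<close>. This ratio bound
  controls the negative increments of \<open>H\<close> in the case \<open>r = 1\<close>.\<close>

section \<open>Positivity of the fundamental solution\<close>

fun impulse :: "real \<Rightarrow> real \<Rightarrow> nat \<Rightarrow> real" where
  "impulse c y 0 = 0"
| "impulse c y (Suc 0) = 0"
| "impulse c y (Suc (Suc 0)) = 1"
| "impulse c y (Suc (Suc (Suc n))) =
     2 * c * impulse c y (Suc (Suc n)) + c * (1 - c) * (1 - y\<^sup>2) * impulse c y (Suc n)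
     + (y\<^sup>2 * (1 - c)\<^sup>2 - c\<^sup>2) * impulse c y n"

definition step_response :: "real \<Rightarrow> real \<Rightarrow> nat \<Rightarrow> real" where
  "step_response c y n = (\<Sum>k\<le>n. impulse c y k)"

lemma step_response_Suc: "step_response c y (Suc n) = step_response c y n + impulse c y (Suc n)"
  by (simp add: step_response_def)

lemma step_response_base:
  "step_response c y 0 = 0" "step_response c y (Suc 0) = 0" "step_response c y (Suc (Suc 0)) = 1"
  by (simp_all add: step_response_def)

text \<open>The constant 1 comes from the initial value of \<open>impulse\<close> at index 2, which
  the recurrence does not generate.\<close>

lemma step_response_rec:
  "step_response c y (Suc (Suc (Suc n))) =
     1 + 2 * c * step_response c y (Suc (Suc n))
     + c * (1 - c) * (1 - y\<^sup>2) * step_response c y (Suc n)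
     + (y\<^sup>2 * (1 - c)\<^sup>2 - c\<^sup>2) * step_response c y n"
proof (induction n)
  case 0
  show ?case by (simp add: step_response_base step_response_Suc)
next
  case (Suc n)
  have "step_response c y (Suc (Suc (Suc (Suc n)))) =
      1 + 2 * c * step_response c y (Suc (Suc n))
      + c * (1 - c) * (1 - y\<^sup>2) * step_response c y (Suc n)
      + (y\<^sup>2 * (1 - c)\<^sup>2 - c\<^sup>2) * step_response c y n + impulse c y (Suc (Suc (Suc (Suc n))))"
    using Suc.IH step_response_Suc[of c y "Suc (Suc (Suc n))"] by linarith
  also have "\<dots> = 1 + 2 * c * (step_response c y (Suc (Suc n)) + impulse c y (Suc (Suc (Suc n))))
      + c * (1 - c) * (1 - y\<^sup>2) * (step_response c y (Suc n) + impulse c y (Suc (Suc n)))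
      + (y\<^sup>2 * (1 - c)\<^sup>2 - c\<^sup>2) * (step_response c y n + impulse c y (Suc n))"
    unfolding impulse.simps(4)[of c y "Suc n"] by (simp only: ring_distribs mult.assoc add_ac)
  finally show ?case by (simp only: step_response_Suc)
qed

section \<open>The case of nonnegative \<open>c\<close>\<close>

text \<open>The differences \<open>T\<close> stay in the unit interval. The scaled value
  \<open>(1 - c) * impulse\<close> moves by convex combinations with them, with weights
  \<open>1 - c\<close> and \<open>c\<close>, so it stays there too.\<close>

lemma impulse_bounds_nonneg:
  assumes c: "0 \<le> c" "c < 1/2" and y: "y\<^sup>2 \<le> 1"
  shows "0 \<le> impulse c y n \<and> (1 - c) * impulse c y n \<le> 1
    \<and> c * impulse c y n \<le> impulse c y (Suc n) \<and> impulse c y (Suc n) \<le> 1 + c * impulse c y n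
    \<and> c * impulse c y (Suc n) \<le> impulse c y (Suc (Suc n))
    \<and> impulse c y (Suc (Suc n)) \<le> 1 + c * impulse c y (Suc n)"
proof (induction n)
  case 0
  show ?case by simp
next
  case (Suc n)
  define T where "T k = impulse c y (Suc k) - c * impulse c y k" for k
  \<comment> \<open>In the variables \<open>T\<close> and \<open>(1 - c) * impulse\<close> the recurrence has nonnegative coefficients
    of sum at most \<open>1\<close>.\<close>
  let ?q = "impulse c y n" and ?d = "c * (1 - (1 - c) * y\<^sup>2)" and ?e = "y\<^sup>2 * (1 - c - c\<^sup>2)"
  have IH: "0 \<le> ?q" "(1 - c) * ?q \<le> 1" "0 \<le> T n" "T n \<le> 1" "0 \<le> T (Suc n)" "T (Suc n) \<le> 1"
    using Suc.IH by (simp_all add: T_def)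
  have T: "T (Suc (Suc n)) = c * T (Suc n) + ?d * T n + ?e * ((1 - c) * ?q)"
    by (simp add: T_def algebra_simps power2_eq_square power3_eq_cube)
  have "(1 - c) * y\<^sup>2 \<le> 1"
    using c y by (intro mult_le_one) auto
  then have d: "0 \<le> ?d" using c by simp
  have "c\<^sup>2 \<le> (1/2)\<^sup>2" using c by (intro power_mono) auto
  then have "c\<^sup>2 \<le> 1/4" by (simp add: power2_eq_square)
  then have e: "0 \<le> ?e" using c by simp
  have q: "0 \<le> (1 - c) * ?q" using IH c by simp
  have "0 \<le> T (Suc (Suc n))"
    unfolding T by (intro add_nonneg_nonneg mult_nonneg_nonneg[OF d] mult_nonneg_nonneg[OF e]
        mult_nonneg_nonneg[OF c(1)] IH q)
  moreover have "T (Suc (Suc n)) \<le> c * 1 + ?d * 1 + ?e * 1"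
    unfolding T by (intro add_mono mult_left_mono IH d e c)
  then have "T (Suc (Suc n)) \<le> 1 - (1 - 2 * c) * (1 - y\<^sup>2)"
    by (simp add: algebra_simps power2_eq_square)
  then have "T (Suc (Suc n)) \<le> 1"
    using c y mult_nonneg_nonneg[of "1 - 2 * c" "1 - y\<^sup>2"] by linarith
  moreover have "0 \<le> c * ?q" using c IH by simp
  then have "0 \<le> impulse c y (Suc n)" using IH by (simp add: T_def)
  moreover have "(1 - c) * impulse c y (Suc n) = (1 - c) * T n + c * ((1 - c) * ?q)"
    by (simp add: T_def algebra_simps)
  moreover have "(1 - c) * T n + c * ((1 - c) * ?q) \<le> (1 - c) * 1 + c * 1"
    using IH c by (intro add_mono mult_left_mono) auto
  ultimately show ?case using IH unfolding T_def by simp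
qed

text \<open>For the pattern \<open>[1, s]\<close> the stationary balance \<open>q\<close> of the last result solves an equation
  \<open>q = m + q * n\<close>; clearing the denominator \<open>1 - n\<close> turns the total profit into
  \<open>- c * y\<close> times the following quantity.\<close>

definition stationary_response :: "real \<Rightarrow> real \<Rightarrow> nat \<Rightarrow> real" where
  "stationary_response c y s = step_response c y (Suc s) - (y\<^sup>2 * (1 - c)\<^sup>2 - c\<^sup>2) *
     (impulse c y s * step_response c y (Suc s) - impulse c y (Suc s) * step_response c y s)"

text \<open>Only one term of \<open>stationary_response\<close> can be negative. For
  \<open>0 \<le> eta\<close> it is absorbed by \<open>eta < 1 - c\<close> and
  \<open>(1 - c) * impulse \<le> 1\<close>. For \<open>eta < 0\<close> it costs at most half of the
  leading term, since the size of \<open>eta\<close> is at most 1/4 and \<open>impulse\<close> at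
  most 2.\<close>

lemma responses_pos_nonneg:
  assumes c: "0 \<le> c" "c < 1/2" and y: "y\<^sup>2 < 1" and s: "0 < s"
  shows "0 < step_response c y (Suc s)" "0 < stationary_response c y s"
proof -
  let ?Q = "impulse c y" and ?H = "step_response c y" and ?eta = "y\<^sup>2 * (1 - c)\<^sup>2 - c\<^sup>2"
  have Q: "0 \<le> ?Q n" "(1 - c) * ?Q n \<le> 1" for n
    using impulse_bounds_nonneg[OF c, of y n] y by auto
  have "mono ?H" by (simp add: mono_iff_le_Suc step_response_Suc Q)
  then have "?H (Suc (Suc 0)) \<le> ?H (Suc s)" using s by (intro monoD[of ?H]) auto
  then show H: "0 < ?H (Suc s)" by (simp add: step_response_base)
  have H0: "0 \<le> ?H s" by (simp add: step_response_def sum_nonneg Q)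
  have HQ: "?H s \<le> ?H (Suc s)" by (simp add: step_response_Suc Q)
  show "0 < stationary_response c y s"
  proof (cases "0 \<le> ?eta")
    case True
    have "?eta \<le> (1 - c) * ((1 - c) * y\<^sup>2)" by (simp add: algebra_simps power2_eq_square)
    also have "(1 - c) * y\<^sup>2 \<le> y\<^sup>2" using c by (intro mult_left_le_one_le) auto
    then have "(1 - c) * ((1 - c) * y\<^sup>2) < (1 - c) * 1"
      using c y by (intro mult_strict_left_mono) auto
    finally have eta: "?eta < 1 - c" by simp
    have "?eta * ?Q s < 1"
    proof (cases "?Q s = 0")
      case False
      then have "?eta * ?Q s < (1 - c) * ?Q s" using eta Q(1)[of s] by (intro mult_strict_right_mono) auto
      then show ?thesis using Q(2)[of s] by linarith
    qed simp
    then have "0 < ?H (Suc s) * (1 - ?eta * ?Q s)" using H by simp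
    moreover have "0 \<le> ?eta * (?Q (Suc s) * ?H s)" using True Q H0 by simp
    ultimately show ?thesis by (simp add: stationary_response_def algebra_simps)
  next
    case False
    have "1 * ?Q (Suc s) \<le> (2 * (1 - c)) * ?Q (Suc s)" using c Q by (intro mult_right_mono) auto
    then have Q2: "?Q (Suc s) \<le> 2" using Q(2)[of "Suc s"] by linarith
    have "c\<^sup>2 \<le> (1/2)\<^sup>2" using c by (intro power_mono) auto
    then have "c\<^sup>2 \<le> 1/4" by (simp add: power2_eq_square)
    moreover have "0 \<le> y\<^sup>2 * (1 - c)\<^sup>2" by simp
    ultimately have eta: "- ?eta \<le> 1/4" by linarith
    have "(- ?eta) * (?Q (Suc s) * ?H s) \<le> 1/4 * (2 * ?H (Suc s))"
      using eta Q2 Q H0 HQ False by (intro mult_mono) auto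
    moreover have "0 \<le> (- ?eta) * (?Q s * ?H (Suc s))" using False Q H by simp
    ultimately show ?thesis using H by (simp add: stationary_response_def algebra_simps)
  qed
qed

section \<open>The case of negative \<open>c\<close>, written as \<open>-b\<close>\<close>

text \<open>Eliminating the constant adds the characteristic root \<open>1\<close>; for \<open>0 < b < 1/2\<close> this makes all
  coefficients except possibly the last nonnegative.\<close>

lemma step_response_homogeneous:
  "step_response (-b) y (Suc (Suc (Suc (Suc n)))) =
     (1 - 2 * b) * step_response (-b) y (Suc (Suc (Suc n)))
     + b * (1 - b + (1 + b) * y\<^sup>2) * step_response (-b) y (Suc (Suc n))
     + (b + (1 + b) * y\<^sup>2) * step_response (-b) y (Suc n)
     - (y\<^sup>2 * (1 + b)\<^sup>2 - b\<^sup>2) * step_response (-b) y n"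
  unfolding step_response_rec[of "-b" y "Suc n"] using step_response_rec[of "-b" y n]
  by (simp add: algebra_simps power2_eq_square)

lemma weight_bound_neg:
  fixes b y :: real
  assumes b: "0 < b" "b < 1/2" and y: "\<bar>y\<bar> * (1 + 2 * b) < 1 - 2 * b"
  shows "y\<^sup>2 * (1 + 2 * b)\<^sup>2 < (1 - 2 * b)\<^sup>2"
proof -
  have "(\<bar>y\<bar> * (1 + 2 * b))\<^sup>2 < (1 - 2 * b)\<^sup>2" using b y by (intro power_strict_mono) auto
  then show ?thesis by (simp add: power_mult_distrib)
qed

text \<open>The first coefficient of the homogeneous recurrence is already \<open>1 - 2 * b\<close>,
  so the claim is that the other three terms add up to something nonnegative. Applying the ratio
  bound for earlier indices reduces this to the inequality \<open>key\<close> between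
  coefficients.\<close>

lemma step_response_ratio:
  assumes b: "0 < b" "b < 1/2" and y: "\<bar>y\<bar> * (1 + 2 * b) < 1 - 2 * b"
  shows "0 \<le> step_response (-b) y n \<and> (1 - 2 * b) * step_response (-b) y n \<le> step_response (-b) y (Suc n)
    \<and> (1 - 2 * b) * step_response (-b) y (Suc n) \<le> step_response (-b) y (Suc (Suc n))
    \<and> (1 - 2 * b) * step_response (-b) y (Suc (Suc n)) \<le> step_response (-b) y (Suc (Suc (Suc n)))"
proof (induction n)
  case 0
  show ?case using step_response_rec[of "-b" y 0] by (simp add: step_response_base)
next
  case (Suc n)
  let ?H = "step_response (-b) y" and ?A = "b * (1 - b + (1 + b) * y\<^sup>2)"
    and ?B = "b + (1 + b) * y\<^sup>2" and ?eta = "y\<^sup>2 * (1 + b)\<^sup>2 - b\<^sup>2"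
  have A: "0 \<le> ?A" and B: "0 \<le> ?B" using b by auto
  have y2: "y\<^sup>2 * (1 + 2 * b)\<^sup>2 < (1 - 2 * b)\<^sup>2" using weight_bound_neg[OF assms] .
  have key: "?eta \<le> (1 - 2 * b) * ((1 - 2 * b) * ?A + ?B)"
  proof -
    have "y\<^sup>2 * ((1 + b) * (1 + 2 * b - 2 * b\<^sup>2)) \<le> (1 - b) * (1 - 2 * b + 2 * b\<^sup>2)"
    proof -
      have "b * b < 1/2 * b" using b by (intro mult_strict_right_mono)
      then have pos: "0 \<le> 1 + 2 * b - 2 * b\<^sup>2" "0 \<le> 1 + 2 * b - 4 * b\<^sup>2"
        unfolding power2_eq_square using b by linarith+
      \<comment> \<open>The factor \<open>(1 + 2 * b)\<^sup>2\<close> allows the upper bound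
        \<open>y2\<close> to replace \<open>y\<close>, leaving a polynomial inequality in
        \<open>b\<close> alone.\<close>
      have "y\<^sup>2 * ((1 + b) * (1 + 2 * b - 2 * b\<^sup>2)) * (1 + 2 * b)\<^sup>2
          = (y\<^sup>2 * (1 + 2 * b)\<^sup>2) * ((1 + b) * (1 + 2 * b - 2 * b\<^sup>2))" by simp
      also have "\<dots> \<le> (1 - 2 * b)\<^sup>2 * ((1 + b) * (1 + 2 * b - 2 * b\<^sup>2))"
        using y2 b pos by (intro mult_right_mono mult_nonneg_nonneg) auto
      also have "\<dots> \<le> (1 - b) * (1 - 2 * b + 2 * b\<^sup>2) * (1 + 2 * b)\<^sup>2"
      proof -
        have "0 \<le> 2 * b * (1 + 2 * b - 4 * b\<^sup>2)"
          using b pos by (intro mult_nonneg_nonneg) auto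
        also have "\<dots> = (1 - b) * (1 - 2 * b + 2 * b\<^sup>2) * (1 + 2 * b)\<^sup>2
            - (1 - 2 * b)\<^sup>2 * ((1 + b) * (1 + 2 * b - 2 * b\<^sup>2))"
          by (simp add: algebra_simps power2_eq_square)
        finally show ?thesis by simp
      qed
      finally show ?thesis using b by (simp add: mult_le_cancel_right)
    qed
    then have "0 \<le> 2 * b * ((1 - b) * (1 - 2 * b + 2 * b\<^sup>2) - y\<^sup>2 * ((1 + b) * (1 + 2 * b - 2 * b\<^sup>2)))"
      using b by simp
    also have "\<dots> = (1 - 2 * b) * ((1 - 2 * b) * ?A + ?B) - ?eta"
      by (simp add: algebra_simps power2_eq_square power3_eq_cube)
    finally show ?thesis by simp
  qed
  have IH: "0 \<le> ?H n" "(1 - 2 * b) * ?H n \<le> ?H (Suc n)" "(1 - 2 * b) * ?H (Suc n) \<le> ?H (Suc (Suc n))"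
    using Suc.IH by auto
  have "?eta * ?H n \<le> ((1 - 2 * b) * ((1 - 2 * b) * ?A + ?B)) * ?H n"
    using key IH by (intro mult_right_mono)
  also have "\<dots> = ?A * ((1 - 2 * b) * ((1 - 2 * b) * ?H n)) + ?B * ((1 - 2 * b) * ?H n)"
    by (simp add: algebra_simps)
  also have "\<dots> \<le> ?A * ?H (Suc (Suc n)) + ?B * ?H (Suc n)"
  proof (intro add_mono mult_left_mono A B)
    have "(1 - 2 * b) * ((1 - 2 * b) * ?H n) \<le> (1 - 2 * b) * ?H (Suc n)"
      using IH b by (intro mult_left_mono) auto
    then show "(1 - 2 * b) * ((1 - 2 * b) * ?H n) \<le> ?H (Suc (Suc n))" using IH by linarith
  qed (use IH in auto)
  finally have "(1 - 2 * b) * ?H (Suc (Suc (Suc n))) \<le> ?H (Suc (Suc (Suc (Suc n))))"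
    unfolding step_response_homogeneous by linarith
  moreover have "0 \<le> ?H (Suc n)" 
  proof -
    have "0 \<le> (1 - 2 * b) * ?H n" using IH b by simp
    then show ?thesis using IH by linarith
  qed
  ultimately show ?case using Suc.IH by auto
qed


lemma step_response_pos_neg:
  assumes b: "0 < b" "b < 1/2" and y: "\<bar>y\<bar> * (1 + 2 * b) < 1 - 2 * b"
  shows "0 < step_response (-b) y (Suc (Suc n))"
proof (induction n)
  case (Suc n)
  then have "0 < (1 - 2 * b) * step_response (-b) y (Suc (Suc n))" using b by simp
  then show ?case using step_response_ratio[OF b y, of "Suc n"] by linarith
qed (simp add: step_response_base)

text \<open>With \<open>d = - eta > 0\<close> the homogeneous recurrence has nonnegative
  coefficients of sum 1, so \<open>step_response\<close> never exceeds its starting maximum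
  1.\<close>

lemma stationary_response_pos_neg_small:
  assumes b: "0 < b" "b < 1/2" and y: "\<bar>y\<bar> * (1 + 2 * b) < 1 - 2 * b" and s: "0 < s"
    and eta: "y\<^sup>2 * (1 + b)\<^sup>2 < b\<^sup>2"
  shows "0 < stationary_response (-b) y s"
proof -
  let ?H = "step_response (-b) y"
  define d where "d = b\<^sup>2 - y\<^sup>2 * (1 + b)\<^sup>2"
  have H1: "?H n \<le> 1 \<and> ?H (Suc n) \<le> 1 \<and> ?H (Suc (Suc n)) \<le> 1 \<and> ?H (Suc (Suc (Suc n))) \<le> 1" for n
  proof (induction n)
    case 0
    show ?case using step_response_rec[of "-b" y 0] b by (simp add: step_response_base)
  next
    case (Suc n)
    have "?H (Suc (Suc (Suc (Suc n)))) = (1 - 2 * b) * ?H (Suc (Suc (Suc n)))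
        + b * (1 - b + (1 + b) * y\<^sup>2) * ?H (Suc (Suc n)) + (b + (1 + b) * y\<^sup>2) * ?H (Suc n) + d * ?H n"
      unfolding step_response_homogeneous by (simp add: d_def algebra_simps)
    also have "\<dots> \<le> (1 - 2 * b) * 1 + b * (1 - b + (1 + b) * y\<^sup>2) * 1 + (b + (1 + b) * y\<^sup>2) * 1 + d * 1"
      using Suc.IH b eta by (intro add_mono mult_left_mono) (auto simp: d_def)
    also have "\<dots> = 1" by (simp add: d_def algebra_simps power2_eq_square)
    finally show ?case using Suc.IH by simp
  qed
  obtain n where n: "s = Suc n" using s gr0_implies_Suc by blast
  \<comment> \<open>Writing \<open>impulse\<close> as differences of \<open>step_response\<close>
    turns the bracket into the square at \<open>s\<close> minus the product of the values at
    \<open>s - 1\<close> and \<open>s + 1\<close>.\<close>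
  have J: "stationary_response (-b) y s = ?H (Suc (Suc n)) * (1 - d * ?H n) + d * (?H (Suc n))\<^sup>2"
    unfolding stationary_response_def n using step_response_Suc[of "-b" y n] step_response_Suc[of "-b" y "Suc n"]
    by (simp add: d_def algebra_simps power2_eq_square)
  have "b\<^sup>2 < 1" using b by (simp add: power_less_one_iff)
  moreover have "0 \<le> y\<^sup>2 * (1 + b)\<^sup>2" by simp
  ultimately have "d < 1" unfolding d_def by linarith
  moreover have "d * ?H n \<le> d * 1" using H1[of n] eta by (intro mult_left_mono) (auto simp: d_def)
  ultimately have p: "0 < 1 - d * ?H n" by linarith
  have "0 < ?H (Suc (Suc n))" using step_response_pos_neg[OF b y] .
  then show ?thesis
    unfolding J using p eta by (intro add_pos_nonneg mult_pos_pos mult_nonneg_nonneg) (auto simp: d_def)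
qed

text \<open>With \<open>h = eta \<ge> 0\<close>, if \<open>impulse\<close> at \<open>Suc s\<close>
  is nonnegative, then \<open>h * impulse < 1\<close> suffices. Otherwise let \<open>-p\<close> be
  its value: the ratio bound on \<open>step_response\<close> limits \<open>p\<close>, and what
  remains to show is \<open>h * V s < 1 - 2 * b\<close>.\<close>

lemma stationary_response_pos_neg_large:
  assumes b: "0 < b" "b < 1/2" and y: "\<bar>y\<bar> * (1 + 2 * b) < 1 - 2 * b" and s: "0 < s"
    and eta: "b\<^sup>2 \<le> y\<^sup>2 * (1 + b)\<^sup>2"
  shows "0 < stationary_response (-b) y s"
proof -
  let ?H = "step_response (-b) y" and ?Q = "impulse (-b) y"
  define h where "h = y\<^sup>2 * (1 + b)\<^sup>2 - b\<^sup>2"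
  define g where "g = b * (1 + b) * (1 - y\<^sup>2)"
  have h0: "0 \<le> h" using eta by (simp add: h_def)
  have y2: "y\<^sup>2 * (1 + 2 * b)\<^sup>2 < (1 - 2 * b)\<^sup>2" using weight_bound_neg[OF b y] .
  have "(1 - 2 * b)\<^sup>2 \<le> 1" using b by (intro power_le_one) auto
  have "1 \<le> (1 + 2 * b)\<^sup>2" using b by (intro one_le_power) auto
  then have "y\<^sup>2 * 1 \<le> y\<^sup>2 * (1 + 2 * b)\<^sup>2" by (intro mult_left_mono) auto
  then have y1: "y\<^sup>2 < 1" using y2 \<open>(1 - 2 * b)\<^sup>2 \<le> 1\<close> by linarith
  then have g0: "0 \<le> g" using b by (simp add: g_def)
  have rec: "?Q (Suc (Suc (Suc n))) = h * ?Q n - 2 * b * ?Q (Suc (Suc n)) - g * ?Q (Suc n)" for n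
    by (simp add: h_def g_def algebra_simps)
  have hb: "h * (1 + 2 * b) < 1 - 2 * b"
  proof -
    have "h * (1 + 2 * b)\<^sup>2 \<le> y\<^sup>2 * (1 + b)\<^sup>2 * (1 + 2 * b)\<^sup>2"
      by (intro mult_right_mono) (auto simp: h_def)
    also have "\<dots> = (y\<^sup>2 * (1 + 2 * b)\<^sup>2) * (1 + b)\<^sup>2" by simp
    also have "\<dots> \<le> (1 - 2 * b)\<^sup>2 * (1 + b)\<^sup>2" using y2 by (intro mult_right_mono) auto
    also have "\<dots> = (1 - 2 * b) * (1 - 3 * b\<^sup>2 - 2 * b ^ 3)"
      by (simp add: algebra_simps power2_eq_square power3_eq_cube)
    also have "\<dots> < (1 - 2 * b) * (1 + 2 * b)"
    proof (rule mult_strict_left_mono)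
      have "0 < b\<^sup>2" "0 < b ^ 3" using b by simp_all
      then show "1 - 3 * b\<^sup>2 - 2 * b ^ 3 < 1 + 2 * b" using b by linarith
    qed (use b in simp)
    finally have "(h * (1 + 2 * b)) * (1 + 2 * b) < (1 - 2 * b) * (1 + 2 * b)"
      by (simp add: power2_eq_square mult.assoc)
    then show ?thesis using b by (simp add: mult_less_cancel_right)
  qed
  have "b * (1 + b) * (1 - y\<^sup>2) \<le> b * 2 * 1" using b y1 by (intro mult_mono) auto
  then have gb: "g \<le> 2 * b" by (simp add: g_def)
  have sum1: "h + 2 * b + g \<le> 1"
  proof -
    \<comment> \<open>The claim amounts to \<open>y\<^sup>2 * (1 + b) \<le> 1 - 3 * b\<close>. The
      lower bound on \<open>y\<close> from \<open>eta\<close> and the upper bound from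
      \<open>y\<close> are compatible only if \<open>0 < 1 - 2 * b - 4 * b\<^sup>2\<close>, and this
      restriction on \<open>b\<close> gives the claim.\<close>
    have "b \<le> \<bar>y\<bar> * (1 + b)"
      by (rule power2_le_imp_le) (use eta b in \<open>auto simp: power_mult_distrib\<close>)
    then have "b * (1 + 2 * b) \<le> (\<bar>y\<bar> * (1 + b)) * (1 + 2 * b)" using b by (intro mult_right_mono) auto
    also have "\<dots> = (\<bar>y\<bar> * (1 + 2 * b)) * (1 + b)" by simp
    also have "\<dots> < (1 - 2 * b) * (1 + b)" using y b by (intro mult_strict_right_mono) auto
    finally have "0 < 1 - 2 * b - 4 * b\<^sup>2" by (simp add: algebra_simps power2_eq_square)
    then have "0 \<le> 4 * b * (1 - 2 * b - 4 * b\<^sup>2)" using b by simp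
    also have "\<dots> = (1 - 3 * b) * (1 + 2 * b)\<^sup>2 - (1 - 2 * b)\<^sup>2 * (1 + b)"
      by (simp add: algebra_simps power2_eq_square)
    finally have "(1 - 2 * b)\<^sup>2 * (1 + b) \<le> (1 - 3 * b) * (1 + 2 * b)\<^sup>2" by simp
    moreover have "(y\<^sup>2 * (1 + 2 * b)\<^sup>2) * (1 + b) \<le> (1 - 2 * b)\<^sup>2 * (1 + b)"
      using y2 b by (intro mult_right_mono) auto
    ultimately have "(y\<^sup>2 * (1 + b)) * (1 + 2 * b)\<^sup>2 \<le> (1 - 3 * b) * (1 + 2 * b)\<^sup>2"
      by (simp add: mult_ac)
    then have "y\<^sup>2 * (1 + b) \<le> 1 - 3 * b" using b by (simp add: mult_le_cancel_right)
    then show ?thesis by (simp add: h_def g_def algebra_simps power2_eq_square)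
  qed
  have Q1: "\<bar>?Q n\<bar> \<le> 1 \<and> \<bar>?Q (Suc n)\<bar> \<le> 1 \<and> \<bar>?Q (Suc (Suc n))\<bar> \<le> 1" for n
  proof (induction n)
    case (Suc n)
    have "\<bar>?Q (Suc (Suc (Suc n)))\<bar> \<le> \<bar>h * ?Q n\<bar> + \<bar>2 * b * ?Q (Suc (Suc n))\<bar> + \<bar>g * ?Q (Suc n)\<bar>"
      unfolding rec by linarith
    also have "\<dots> \<le> h * 1 + 2 * b * 1 + g * 1"
      unfolding abs_mult using Suc.IH h0 g0 b by (intro add_mono mult_mono) auto
    also have "\<dots> \<le> 1" using sum1 by simp
    finally show ?case using Suc.IH by simp
  qed simp
  have h1: "h < 1 - 2 * b" 
  proof -
    have "0 \<le> h * (2 * b)" using h0 b by simp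
    moreover have "h * (1 + 2 * b) = h + h * (2 * b)" by (simp add: distrib_left)
    ultimately show ?thesis using hb by linarith
  qed
  have hQ: "h * ?Q n < 1" for n
  proof -
    have "h * ?Q n \<le> h * 1" using Q1[of n] h0 by (intro mult_left_mono) auto
    then show ?thesis using h1 b by linarith
  qed
  \<comment> \<open>A three-step recursion for \<open>V\<close> closes because \<open>h * (1 + 2 * b) < 1 - 2 * b\<close>.\<close>
  define V where "V n = (1 - 2 * b) * ?Q n - ?Q (Suc n)" for n
  have V: "h * V n < 1 - 2 * b \<and> h * V (Suc n) < 1 - 2 * b \<and> h * V (Suc (Suc n)) < 1 - 2 * b" for n
  proof (induction n)
    case 0
    show ?case using h0 h1 b by (auto simp: V_def)
  next
    case (Suc n)
    \<comment> \<open>For negative \<open>impulse\<close> at \<open>Suc n\<close> the scaled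
      difference is at most \<open>V n\<close>, so the induction hypothesis three steps before the
      target applies.\<close>
    have v: "h * (?Q n - ?Q (Suc n)) \<le> 1"
    proof (cases "0 \<le> ?Q (Suc n)")
      case True
      then have "0 \<le> h * ?Q (Suc n)" using h0 by simp
      then show ?thesis using hQ[of n] by (simp add: right_diff_distrib)
    next
      case False
      have "2 * b * ?Q (Suc n) \<le> 0" using b False by (intro mult_nonneg_nonpos) auto
      then have "(1 - 2 * b) * (?Q n - ?Q (Suc n)) \<le> V n" by (simp add: V_def algebra_simps)
      then have "h * ((1 - 2 * b) * (?Q n - ?Q (Suc n))) \<le> h * V n" using h0 by (intro mult_left_mono)
      then have "(1 - 2 * b) * (h * (?Q n - ?Q (Suc n))) \<le> (1 - 2 * b) * 1"
        using Suc.IH by (simp add: mult.left_commute)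
      then show ?thesis using b by (simp add: mult_le_cancel_left)
    qed
    have "V (Suc (Suc (Suc n))) = ?Q (Suc (Suc (Suc n))) + g * ?Q (Suc (Suc n)) - h * ?Q (Suc n)"
      unfolding V_def rec[of "Suc n"] by (simp add: algebra_simps)
    also have "\<dots> = h * (?Q n - ?Q (Suc n)) + (2 * b - g) * (- ?Q (Suc (Suc n))) + g * (- ?Q (Suc n))"
      unfolding rec by (simp add: algebra_simps)
    also have "\<dots> \<le> 1 + (2 * b - g) * 1 + g * 1"
      using v Q1[of n] gb g0 by (intro add_mono mult_left_mono) auto
    finally have "h * V (Suc (Suc (Suc n))) \<le> h * (1 + 2 * b)" using h0 by (intro mult_left_mono) auto
    then show ?case using Suc.IH hb by linarith
  qed
  obtain n where n: "s = Suc n" using s gr0_implies_Suc by blast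
  have H: "0 < ?H (Suc s)" using step_response_pos_neg[OF b y] n by simp
  have H0: "0 \<le> ?H s" using step_response_ratio[OF b y, of s] by simp
  have J: "stationary_response (-b) y s = ?H (Suc s) * (1 - h * ?Q s) + h * (?Q (Suc s) * ?H s)"
    unfolding stationary_response_def by (simp add: h_def algebra_simps)
  show ?thesis
  proof (cases "0 \<le> ?Q (Suc s)")
    case True
    then show ?thesis unfolding J using H H0 h0 hQ[of s]
      by (intro add_pos_nonneg mult_pos_pos mult_nonneg_nonneg) auto
  next
    case False
    define p where "p = - ?Q (Suc s)"
    have p: "0 < p" using False by (simp add: p_def)
    have Hs: "?H s = ?H (Suc s) + p" by (simp add: step_response_Suc p_def)
    have "(1 - 2 * b) * ?H s \<le> ?H (Suc s)" using step_response_ratio[OF b y, of s] by simp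
    then have "(1 - 2 * b) * p \<le> 2 * b * ?H (Suc s)" unfolding Hs by (simp add: algebra_simps)
    then have "h * p * ((1 - 2 * b) * p) \<le> h * p * (2 * b * ?H (Suc s))"
      using h0 p by (intro mult_left_mono) auto
    moreover have "(1 - 2 * b) * stationary_response (-b) y s =
        ?H (Suc s) * ((1 - 2 * b) - h * V s) + (h * p * (2 * b * ?H (Suc s)) - h * p * ((1 - 2 * b) * p))"
      unfolding J V_def Hs by (simp add: p_def algebra_simps)
    moreover have "0 < ?H (Suc s) * ((1 - 2 * b) - h * V s)" using H V[of s] by simp
    ultimately have "0 < (1 - 2 * b) * stationary_response (-b) y s" by linarith
    then show ?thesis using b by (simp add: zero_less_mult_iff)
  qed
qed

text \<open>In the parametrization of \<open>game_B_eq\<close>, hypothesis \<open>cy\<close> says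
  that \<open>p0 < 1\<close> and \<open>p3 > 0\<close>.\<close>

lemma responses_pos:
  assumes c: "\<bar>c\<bar> < 1/2" and y: "\<bar>y\<bar> < 1" and cy: "\<bar>y\<bar> * (1 - 2 * c) < 1 + 2 * c" and s: "0 < s"
  shows "0 < step_response c y (Suc s)" "0 < stationary_response c y s"
proof -
  have y2: "y\<^sup>2 < 1" using y by (simp add: abs_square_less_1)
  obtain n where n: "s = Suc n" using s gr0_implies_Suc by blast
  show "0 < step_response c y (Suc s)" "0 < stationary_response c y s"
    using responses_pos_nonneg[of c y s] step_response_pos_neg[of "-c" y n]
      stationary_response_pos_neg_small[of "-c" y s] stationary_response_pos_neg_large[of "-c" y s]
      c y2 cy s n by (cases "0 \<le> c"; force)+
qed

section \<open>The patterns as a linear recurrence\<close>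

lemma transition_mat_carrier: "transition_mat p0 p1 p2 p3 \<in> carrier_mat 4 4"
  unfolding transition_mat_def mat_of_rows_list_def by (rule carrier_matI) simp_all

lemma game_A_carrier: "game_A \<in> carrier_mat 4 4"
  and game_B_carrier: "game_B kappa lambda \<in> carrier_mat 4 4"
  by (simp_all add: game_A_def game_B_def transition_mat_carrier)

lemma row_vec_mult_carrier: "M \<in> carrier_mat m n \<Longrightarrow> row_vec_mult v M \<in> carrier_vec n"
  by (auto simp: row_vec_mult_def)

lemma row_vec_mult_eq_transpose:
  assumes "v \<in> carrier_vec m" "M \<in> carrier_mat m n"
  shows "row_vec_mult v M = transpose_mat M *\<^sub>v v"
  using assms by (auto simp: row_vec_mult_def intro!: eq_vecI comm_scalar_prod)

lemma row_vec_mult_mult: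
  assumes v: "v \<in> carrier_vec k" and M: "M \<in> carrier_mat k m" and N: "N \<in> carrier_mat m n"
  shows "row_vec_mult v (M * N) = row_vec_mult (row_vec_mult v M) N"
proof -
  have "row_vec_mult v (M * N) = transpose_mat N * transpose_mat M *\<^sub>v v"
    using assms by (simp add: row_vec_mult_eq_transpose[of v k "M * N" n] transpose_mult[OF M N])
  also have "\<dots> = transpose_mat N *\<^sub>v (transpose_mat M *\<^sub>v v)"
    using assms by (intro assoc_mult_mat_vec[of _ n m _ k]) auto
  also have "\<dots> = row_vec_mult (row_vec_mult v M) N"
    using row_vec_mult_eq_transpose[OF v M]
      row_vec_mult_eq_transpose[OF row_vec_mult_carrier[OF M, of v] N] by simp
  finally show ?thesis .
qed

lemma row_vec_mult_one: "v \<in> carrier_vec n \<Longrightarrow> row_vec_mult v (1\<^sub>m n) = v"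
  by (simp add: row_vec_mult_eq_transpose[of v n _ n])

lemma sum_lessThan_4: "(\<Sum>i<4. f i) = f 0 + f (Suc 0) + f 2 + f 3" for f :: "nat \<Rightarrow> real"
  by (simp add: eval_nat_numeral)

lemma transition_mat_index:
  assumes "i < 4" "j < 4"
  shows "transition_mat p0 p1 p2 p3 $$ (i, j) =
    [[1 - p0, p0, 0, 0], [0, 0, 1 - p1, p1], [1 - p2, p2, 0, 0], [0, 0, 1 - p3, p3]] ! i ! j"
  using assms by (simp add: transition_mat_def mat_of_rows_list_def)

lemma row_vec_mult_index:
  assumes "v \<in> carrier_vec m" "M \<in> carrier_mat m n" "j < n"
  shows "row_vec_mult v M $ j = (\<Sum>i<m. v $ i * M $$ (i, j))"
  using assms by (simp add: row_vec_mult_def scalar_prod_def atLeast0LessThan)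

lemma row_vec_mult_transition:
  assumes "v \<in> carrier_vec 4"
  shows "row_vec_mult v (transition_mat p0 p1 p2 p3) $ 0 = v $ 0 * (1 - p0) + v $ 2 * (1 - p2)"
    "row_vec_mult v (transition_mat p0 p1 p2 p3) $ Suc 0 = v $ 0 * p0 + v $ 2 * p2"
    "row_vec_mult v (transition_mat p0 p1 p2 p3) $ 2 = v $ Suc 0 * (1 - p1) + v $ 3 * (1 - p3)"
    "row_vec_mult v (transition_mat p0 p1 p2 p3) $ 3 = v $ Suc 0 * p1 + v $ 3 * p3"
  by (simp_all add: row_vec_mult_index[OF assms transition_mat_carrier] sum_lessThan_4 transition_mat_index)

text \<open>In state \<open>2 * a + b\<close> the newest result is \<open>b\<close> and the older one is \<open>a\<close>.
  With results counted as \<open>1\<close> and \<open>-1\<close>, the next three functionals are the expectations of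
  the newest result, of the older result, and of their product.\<close>

definition balance :: "real vec \<Rightarrow> real" where
  "balance v = v $ Suc 0 + v $ 3 - v $ 0 - v $ 2"

definition older_balance :: "real vec \<Rightarrow> real" where
  "older_balance v = v $ 2 + v $ 3 - v $ 0 - v $ Suc 0"

definition result_corr :: "real vec \<Rightarrow> real" where
  "result_corr v = v $ 0 + v $ 3 - v $ Suc 0 - v $ 2"

lemma payoff_mat_index:
  assumes "i < 4" "j < 4"
  shows "payoff_mat $$ (i, j) = [[-1, 1, 0, 0], [0, 0, -1, 1], [-1, 1, 0, 0], [0, 0, -1, 1]] ! i ! j"
  using assms by (simp add: payoff_mat_def mat_of_rows_list_def)

lemma expected_payoff_transition:
  assumes "v \<in> carrier_vec 4"
  shows "expected_payoff v (transition_mat p0 p1 p2 p3) =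
    balance (row_vec_mult v (transition_mat p0 p1 p2 p3))"
  by (simp add: expected_payoff_def balance_def row_vec_mult_transition[OF assms] sum_lessThan_4
      transition_mat_index payoff_mat_index)

definition is_distribution :: "real vec \<Rightarrow> bool" where
  "is_distribution v \<longleftrightarrow> v \<in> carrier_vec 4 \<and> (\<forall>i<4. 0 \<le> v $ i) \<and> (\<Sum>i<4. v $ i) = 1"

lemma all_less_4: "(\<forall>i<4. P i) \<longleftrightarrow> P 0 \<and> P (Suc 0) \<and> P 2 \<and> P (3::nat)"
  by (simp add: numeral_eq_Suc All_less_Suc) metis

lemma vec4_eqI:
  assumes "v \<in> carrier_vec 4" "w \<in> carrier_vec 4"
    "v $ 0 = w $ 0" "v $ Suc 0 = w $ Suc 0" "v $ 2 = w $ 2" "v $ 3 = w $ 3"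
  shows "v = w"
proof -
  have "\<forall>i<4. v $ i = w $ i" using assms by (simp add: all_less_4)
  then show ?thesis using assms by (intro eq_vecI) auto
qed

text \<open>Every state wins and loses with probability at least the smallest entry
  \<open>e > 0\<close>. The strict bound on the balance later keeps the denominator
  \<open>1 - n\<close> positive.\<close>

lemma distribution_step:
  assumes v: "is_distribution v"
    and p: "0 < p0" "p0 < 1" "0 < p1" "p1 < 1" "0 < p2" "p2 < 1" "0 < p3" "p3 < 1"
  defines "w \<equiv> row_vec_mult v (transition_mat p0 p1 p2 p3)"
  shows "is_distribution w" "\<bar>balance w\<bar> < 1"
proof -
  let ?S = "{p0, 1 - p0, p1, 1 - p1, p2, 1 - p2, p3, 1 - p3}"
  define e where "e = Min ?S"
  have e: "0 < e" unfolding e_def using p by (subst Min_gr_iff) auto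
  have "e \<le> x" if "x \<in> ?S" for x unfolding e_def using that by (intro Min_le) auto
  then have pe: "e \<le> p0" "e \<le> 1 - p0" "e \<le> p1" "e \<le> 1 - p1"
    "e \<le> p2" "e \<le> 1 - p2" "e \<le> p3" "e \<le> 1 - p3" by blast+
  have vc: "v \<in> carrier_vec 4" and v0: "0 \<le> v $ 0" "0 \<le> v $ Suc 0" "0 \<le> v $ 2" "0 \<le> v $ 3"
    and v1: "v $ 0 + v $ Suc 0 + v $ 2 + v $ 3 = 1"
    using v by (auto simp: is_distribution_def all_less_4 sum_lessThan_4)
  note w = row_vec_mult_transition[OF vc, of p0 p1 p2 p3, folded w_def]
  have wc: "w \<in> carrier_vec 4" unfolding w_def by (rule row_vec_mult_carrier[OF transition_mat_carrier])
  have sum: "w $ 0 + w $ Suc 0 + w $ 2 + w $ 3 = 1" unfolding w using v1 by (simp add: algebra_simps)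
  have nn: "0 \<le> w $ 0" "0 \<le> w $ Suc 0" "0 \<le> w $ 2" "0 \<le> w $ 3"
    unfolding w using pe e v0 by simp_all
  then show "is_distribution w" using wc sum by (auto simp: is_distribution_def all_less_4 sum_lessThan_4)
  have "v $ 0 * e + v $ Suc 0 * e + v $ 2 * e + v $ 3 * e \<le>
      v $ 0 * p0 + v $ Suc 0 * p1 + v $ 2 * p2 + v $ 3 * p3"
    using pe v0 by (intro add_mono mult_left_mono) auto
  moreover have "v $ 0 * e + v $ Suc 0 * e + v $ 2 * e + v $ 3 * e \<le>
      v $ 0 * (1 - p0) + v $ Suc 0 * (1 - p1) + v $ 2 * (1 - p2) + v $ 3 * (1 - p3)"
    using pe v0 by (intro add_mono mult_left_mono) auto
  moreover have "v $ 0 * e + v $ Suc 0 * e + v $ 2 * e + v $ 3 * e = e"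
    using v1 by (metis distrib_right mult_1)
  ultimately have "0 < w $ Suc 0 + w $ 3" "0 < w $ 0 + w $ 2" unfolding w using e by auto
  then show "\<bar>balance w\<bar> < 1" using sum by (simp add: balance_def)
qed

text \<open>The distribution after one play of game \<open>A\<close>: the previous result has balance \<open>q\<close>, and the
  newest one is a fair coin.\<close>

definition drawn_start :: "real \<Rightarrow> real vec" where
  "drawn_start q = vec 4 (\<lambda>i. if i < 2 then (1 - q) / 4 else (1 + q) / 4)"

lemma drawn_start_simps:
  "drawn_start q \<in> carrier_vec 4"
  "drawn_start q $ 0 = (1 - q) / 4" "drawn_start q $ Suc 0 = (1 - q) / 4"
  "drawn_start q $ 2 = (1 + q) / 4" "drawn_start q $ 3 = (1 + q) / 4"
  by (simp_all add: drawn_start_def)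

lemma drawn_start_balances:
  "balance (drawn_start q) = 0" "older_balance (drawn_start q) = q" "result_corr (drawn_start q) = 0"
  by (simp_all add: balance_def older_balance_def result_corr_def drawn_start_simps field_simps)

lemma is_distribution_drawn_start: "\<bar>q\<bar> \<le> 1 \<Longrightarrow> is_distribution (drawn_start q)"
  by (auto simp: is_distribution_def all_less_4 sum_lessThan_4 drawn_start_simps field_simps)

lemma play_game_A:
  assumes v: "v \<in> carrier_vec 4" "(\<Sum>i<4. v $ i) = 1"
  shows "row_vec_mult v game_A = drawn_start (balance v)"
proof -
  have "v $ 0 = 1 - v $ Suc 0 - v $ 2 - v $ 3" using v(2) by (simp add: sum_lessThan_4)
  then show ?thesis
    unfolding game_A_def using v(1)
    by (intro vec4_eqI row_vec_mult_carrier[OF transition_mat_carrier])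
       (simp_all add: drawn_start_simps row_vec_mult_transition balance_def field_simps)
qed

lemma play_game_A_pow:
  assumes v: "v \<in> carrier_vec 4" "(\<Sum>i<4. v $ i) = 1" and r: "0 < r"
  shows "row_vec_mult v (game_A ^\<^sub>m r) = drawn_start (if r = 1 then balance v else 0)"
proof -
  have "row_vec_mult v (game_A ^\<^sub>m Suc n) = drawn_start (if n = 0 then balance v else 0)" for n
  proof (induction n)
    case 0
    show ?case using play_game_A[OF v] game_A_carrier by (simp add: left_mult_one_mat[OF game_A_carrier])
  next
    case (Suc n)
    have "row_vec_mult v (game_A ^\<^sub>m Suc (Suc n)) =
        row_vec_mult (row_vec_mult v (game_A ^\<^sub>m Suc n)) game_A"
      using row_vec_mult_mult[OF v(1) pow_carrier_mat[OF game_A_carrier, of "Suc n"] game_A_carrier]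
      by simp
    also have "\<dots> = drawn_start 0"
      unfolding Suc.IH
      by (subst play_game_A) (simp_all add: drawn_start_simps drawn_start_balances sum_lessThan_4 field_simps)
    finally show ?case by simp
  qed
  then show ?thesis using r by (cases r) auto
qed

lemma expected_payoff_game_A:
  assumes "v \<in> carrier_vec 4"
  shows "expected_payoff v game_A = 0"
  unfolding game_A_def expected_payoff_transition[OF assms]
  using assms by (simp add: balance_def row_vec_mult_transition)


section \<open>Game \<open>B\<close> in the coordinates \<open>c\<close> and
  \<open>y\<close>\<close>

text \<open>Here \<open>y = 1 - 2 * p1\<close> and \<open>2 * c = p3 - p0\<close>. The three
  distinct probabilities depend on two parameters, which shows as the relation
  \<open>p0 + p3 - 1 = y * (1 - 2 * c)\<close>.\<close>

lemma game_B_eq: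
  assumes "0 < kappa" "0 < lambda"
    and c: "c = (kappa - lambda) / (2 * (1 + kappa))" and y: "y = (1 - lambda) / (1 + lambda)"
  shows "game_B kappa lambda = transition_mat ((1 + y * (1 - 2 * c) - 2 * c) / 2) ((1 - y) / 2)
    ((1 - y) / 2) ((1 + y * (1 - 2 * c) + 2 * c) / 2)"
proof -
  have "1 + kappa \<noteq> 0" "1 + lambda \<noteq> 0" using assms by auto
  have tc: "2 * c = (kappa - lambda) / (1 + kappa)"
    unfolding c times_divide_eq_right by (rule mult_divide_mult_cancel_left) simp
  have "1 - 2 * c = (1 + lambda) / (1 + kappa)" unfolding tc using \<open>1 + kappa \<noteq> 0\<close> by (simp add: field_simps)
  then have yc: "y * (1 - 2 * c) = (1 - lambda) / (1 + kappa)"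
    using \<open>1 + lambda \<noteq> 0\<close> by (simp add: y)
  define u where "u = inverse (1 + kappa)"
  have ku: "kappa * u = 1 - u" using \<open>1 + kappa \<noteq> 0\<close> by (simp add: u_def field_simps)
  have "1 / (1 + kappa) = (1 + y * (1 - 2 * c) - 2 * c) / 2"
    "1 - lambda / (1 + kappa) = (1 + y * (1 - 2 * c) + 2 * c) / 2"
    unfolding yc unfolding tc unfolding divide_inverse[of _ "1 + kappa"] u_def[symmetric] left_diff_distrib ku
    by simp_all
  moreover have "lambda / (1 + lambda) = (1 - y) / 2"
    using \<open>1 + lambda \<noteq> 0\<close> by (simp add: y field_simps)
  ultimately show ?thesis unfolding game_B_def by (simp only:)
qed

text \<open>Together with the total mass, the three functionals are linear coordinates on the state
  vectors, so this describes a play of \<open>B\<close> completely.\<close>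

lemma balances_step:
  assumes v: "v \<in> carrier_vec 4" "(\<Sum>i<4. v $ i) = 1"
    and B: "B = transition_mat ((1 + y * (1 - 2 * c) - 2 * c) / 2) ((1 - y) / 2)
      ((1 - y) / 2) ((1 + y * (1 - 2 * c) + 2 * c) / 2)"
  shows "older_balance (row_vec_mult v B) = balance v"
    "balance (row_vec_mult v B) = - c * y + c * (balance v + older_balance v) + y * (1 - c) * result_corr v"
    "result_corr (row_vec_mult v B) = - c * y * balance v + c * (1 + result_corr v) + y * (1 - c) * older_balance v"
proof -
  have v0: "v $ 0 = 1 - v $ Suc 0 - v $ 2 - v $ 3" using v(2) by (simp add: sum_lessThan_4)
  show "older_balance (row_vec_mult v B) = balance v"
    unfolding B older_balance_def balance_def row_vec_mult_transition[OF v(1)] by (simp add: algebra_simps)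
  show "balance (row_vec_mult v B) = - c * y + c * (balance v + older_balance v) + y * (1 - c) * result_corr v"
    unfolding B older_balance_def balance_def result_corr_def row_vec_mult_transition[OF v(1)] v0
    by (simp add: field_simps)
  show "result_corr (row_vec_mult v B) = - c * y * balance v + c * (1 + result_corr v) + y * (1 - c) * older_balance v"
    unfolding B older_balance_def balance_def result_corr_def row_vec_mult_transition[OF v(1)] v0
    by (simp add: field_simps)
qed

lemma row_vec_mult_pow_Suc:
  assumes "v \<in> carrier_vec n" "M \<in> carrier_mat n n"
  shows "row_vec_mult v (M ^\<^sub>m Suc t) = row_vec_mult (row_vec_mult v (M ^\<^sub>m t)) M"
  using row_vec_mult_mult[OF assms(1) pow_carrier_mat[OF assms(2), of t] assms(2)] by simp

lemma balance_two_steps: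
  assumes v: "v \<in> carrier_vec 4" "(\<Sum>i<4. v $ i) = 1" and w: "w = row_vec_mult v B" "(\<Sum>i<4. w $ i) = 1"
    and B: "B = transition_mat ((1 + y * (1 - 2 * c) - 2 * c) / 2) ((1 - y) / 2)
      ((1 - y) / 2) ((1 + y * (1 - 2 * c) + 2 * c) / 2)"
  shows "balance (row_vec_mult w B) = 2 * c * balance w + c * (1 - c) * (1 - y\<^sup>2) * balance v
    + (y\<^sup>2 * (1 - c)\<^sup>2 - c\<^sup>2) * older_balance v"
proof -
  have wc: "w \<in> carrier_vec 4"
    unfolding w(1) B by (rule row_vec_mult_carrier[OF transition_mat_carrier])
  \<comment> \<open>This eliminates the correlation without dividing by \<open>y * (1 - c)\<close>,
    which may vanish. The constant terms then cancel, so the recurrence is homogeneous.\<close>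
  define d where "d = balance w + c * y - c * (balance v + older_balance v)"
  have d: "d = y * (1 - c) * result_corr v"
    unfolding d_def w(1) balances_step(2)[OF v B] by simp
  have "balance (row_vec_mult w B) = - c * y + c * (balance w + balance v)
      + y * (1 - c) * (- c * y * balance v + c * (1 + result_corr v) + y * (1 - c) * older_balance v)"
    unfolding balances_step(2)[OF wc w(2) B] unfolding w(1) balances_step(1,3)[OF v B] ..
  also have "\<dots> = - c * y + c * (balance w + balance v)
      + y * (1 - c) * (- c * y * balance v + c + y * (1 - c) * older_balance v) + c * d"
    unfolding d by (simp add: algebra_simps)
  also have "\<dots> = 2 * c * balance w + c * (1 - c) * (1 - y\<^sup>2) * balance v
    + (y\<^sup>2 * (1 - c)\<^sup>2 - c\<^sup>2) * older_balance v"
    unfolding d_def by (simp add: algebra_simps power2_eq_square)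
  finally show ?thesis .
qed

lemma play_transition_pow:
  assumes v: "is_distribution v"
    and p: "0 < p0" "p0 < 1" "0 < p1" "p1 < 1" "0 < p2" "p2 < 1" "0 < p3" "p3 < 1"
    and B: "B = transition_mat p0 p1 p2 p3"
  shows "is_distribution (row_vec_mult v (B ^\<^sub>m t))" "0 < t \<Longrightarrow> \<bar>balance (row_vec_mult v (B ^\<^sub>m t))\<bar> < 1"
proof -
  have vc: "v \<in> carrier_vec 4" and Bc: "B \<in> carrier_mat 4 4"
    using v by (simp_all add: is_distribution_def B transition_mat_carrier)
  show dist: "is_distribution (row_vec_mult v (B ^\<^sub>m t))" for t
  proof (induction t)
    case 0
    show ?case using v Bc vc by (simp add: row_vec_mult_one)
  next
    case (Suc t)
    show ?case unfolding row_vec_mult_pow_Suc[OF vc Bc] unfolding B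
      by (rule distribution_step(1)[OF Suc.IH[unfolded B] p])
  qed
  assume "0 < t"
  then obtain k where k: "t = Suc k" using gr0_implies_Suc by blast
  show "\<bar>balance (row_vec_mult v (B ^\<^sub>m t))\<bar> < 1"
    unfolding k row_vec_mult_pow_Suc[OF vc Bc] unfolding B
    by (rule distribution_step(2)[OF dist[unfolded B] p])
qed

text \<open>Both sides satisfy the same third-order recurrence and agree at times 0, 1 and 2. The
  older balance \<open>q\<close> of the start acts as the balance at time -1.\<close>

lemma balance_play:
  assumes B: "B = transition_mat ((1 + y * (1 - 2 * c) - 2 * c) / 2) ((1 - y) / 2)
      ((1 - y) / 2) ((1 + y * (1 - 2 * c) + 2 * c) / 2)"
    and dist: "\<And>t. is_distribution (row_vec_mult (drawn_start q) (B ^\<^sub>m t))"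
  shows "balance (row_vec_mult (drawn_start q) (B ^\<^sub>m t)) =
    (q - y) * c * impulse c y (Suc t) + q * (y\<^sup>2 * (1 - c)\<^sup>2 - c\<^sup>2) * impulse c y t"
proof -
  define x where "x t = row_vec_mult (drawn_start q) (B ^\<^sub>m t)" for t
  have Bc: "B \<in> carrier_mat 4 4" by (simp add: B transition_mat_carrier)
  have x0: "x 0 = drawn_start q" using Bc by (simp add: x_def row_vec_mult_one drawn_start_simps)
  have xS: "x (Suc t) = row_vec_mult (x t) B" for t
    unfolding x_def by (rule row_vec_mult_pow_Suc[OF drawn_start_simps(1) Bc])
  have x: "x t \<in> carrier_vec 4" "(\<Sum>i<4. x t $ i) = 1" for t
    using dist[of t] by (auto simp: x_def is_distribution_def)
  have step: "balance (x (Suc (Suc t))) = 2 * c * balance (x (Suc t)) + c * (1 - c) * (1 - y\<^sup>2) * balance (x t)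
      + (y\<^sup>2 * (1 - c)\<^sup>2 - c\<^sup>2) * older_balance (x t)" for t
    using balance_two_steps[OF x xS x(2) B] by (simp add: xS)
  have older: "older_balance (x (Suc t)) = balance (x t)" for t
    using balances_step(1)[OF x B] by (simp add: xS)
  let ?P = "\<lambda>t. balance (x t) =
    (q - y) * c * impulse c y (Suc t) + q * (y\<^sup>2 * (1 - c)\<^sup>2 - c\<^sup>2) * impulse c y t"
  have "?P t \<and> ?P (Suc t) \<and> ?P (Suc (Suc t))"
  proof (induction t)
    case 0
    have b0: "balance (x 0) = 0" "older_balance (x 0) = q" "result_corr (x 0) = 0"
      by (simp_all add: x0 drawn_start_balances)
    then have b1: "balance (x (Suc 0)) = (q - y) * c"
      unfolding xS balances_step(2)[OF x B] by (simp add: algebra_simps)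
    have "balance (x (Suc (Suc 0))) = 2 * c * ((q - y) * c) + (y\<^sup>2 * (1 - c)\<^sup>2 - c\<^sup>2) * q"
      unfolding step[of 0] b0 b1 by simp
    then show ?case using b0 b1 by simp
  next
    case (Suc t)
    have "?P (Suc (Suc (Suc t)))"
      unfolding step[of "Suc t"] older using Suc.IH
      unfolding impulse.simps(4)[of c y t] impulse.simps(4)[of c y "Suc t"]
      by (simp only: ring_distribs mult_ac)
    then show ?case using Suc.IH by blast
  qed
  then show ?thesis by (simp add: x_def)
qed

section \<open>Stationary distribution and total profit\<close>

lemma mean_profit_sign:
  assumes pos: "0 < kappa" "0 < lambda" "lambda < 1 + kappa" and r: "0 < r" and s: "0 < s"
    and c: "c = (kappa - lambda) / (2 * (1 + kappa))" and y: "y = (1 - lambda) / (1 + lambda)"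
  shows "\<exists>K>0. mean_profit kappa lambda r s = K * (- (c * y))"
proof -
  define B where "B = game_B kappa lambda"
  define eta where "eta = y\<^sup>2 * (1 - c)\<^sup>2 - c\<^sup>2"
  let ?Q = "impulse c y" and ?H = "step_response c y"
  have B: "B = transition_mat ((1 + y * (1 - 2 * c) - 2 * c) / 2) ((1 - y) / 2)
      ((1 - y) / 2) ((1 + y * (1 - 2 * c) + 2 * c) / 2)"
    unfolding B_def by (rule game_B_eq[OF pos(1,2) c y])
  have Bc: "B \<in> carrier_mat 4 4" by (simp add: B_def game_B_carrier)
  have "0 < 1 / (1 + kappa)" "1 / (1 + kappa) < 1" "0 < lambda / (1 + lambda)" "lambda / (1 + lambda) < 1"
    "0 < 1 - lambda / (1 + kappa)" "1 - lambda / (1 + kappa) < 1"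
    using pos by (simp_all add: field_simps)
  note play = play_transition_pow[OF _ this(1-4) this(3-6), of _ B, OF _ B_def[unfolded game_B_def]]
  have x_dist: "is_distribution (row_vec_mult (drawn_start q) (B ^\<^sub>m t))" if "\<bar>q\<bar> \<le> 1" for q t
    by (rule play(1)[OF is_distribution_drawn_start[OF that]])
  have x_bal: "balance (row_vec_mult (drawn_start q) (B ^\<^sub>m t)) = (q - y) * c * ?Q (Suc t) + q * eta * ?Q t"
    if "\<bar>q\<bar> \<le> 1" for q t
    unfolding eta_def by (rule balance_play[OF B x_dist[OF that]])
  define m where "m = - y * c * ?Q (Suc s)"
  define n where "n = c * ?Q (Suc s) + eta * ?Q s"
  have bal: "balance (row_vec_mult (drawn_start q) (B ^\<^sub>m s)) = m + q * n" if "\<bar>q\<bar> \<le> 1" for q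
    unfolding x_bal[OF that] m_def n_def by (simp add: algebra_simps)
  have "\<bar>m + q * n\<bar> < 1" if "\<bar>q\<bar> \<le> 1" for q
    using play(2)[OF is_distribution_drawn_start[OF that] s] bal[OF that] by simp
  \<comment> \<open>The balance after the block of \<open>B\<close> is affine in \<open>q\<close>.
    Its values at both ends of the range of \<open>q\<close> give
    \<open>\<bar>m\<bar> < 1 - n\<close>, so the fixed point \<open>m / (1 - n)\<close> is unique
    and admissible.\<close>
  from this[of 1] this[of "-1"] have mn: "\<bar>m + n\<bar> < 1" "\<bar>m - n\<bar> < 1" by simp_all
  then have n1: "n < 1" and mn1: "\<bar>m\<bar> < 1 - n" by linarith+
  define q where "q = (if r = 1 then m / (1 - n) else 0)"
  have q1: "\<bar>q\<bar> \<le> 1" using n1 mn1 by (simp add: q_def abs_divide)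
  define P where "P = game_A ^\<^sub>m r * B ^\<^sub>m s"
  have Ac: "game_A ^\<^sub>m r \<in> carrier_mat 4 4" by (rule pow_carrier_mat[OF game_A_carrier])
  have play_pattern: "row_vec_mult v (game_A ^\<^sub>m r * B ^\<^sub>m t) =
      row_vec_mult (drawn_start (if r = 1 then balance v else 0)) (B ^\<^sub>m t)" if "is_distribution v" for v t
    using that row_vec_mult_mult[OF _ Ac pow_carrier_mat[OF Bc, of t], of v] play_game_A_pow[of v r, OF _ _ r]
    by (simp add: is_distribution_def)
  have stat: "is_stationary_distribution P v \<longleftrightarrow> is_distribution v \<and> row_vec_mult v P = v" for v
    using Ac by (auto simp: is_stationary_distribution_def is_distribution_def P_def)
  define v where "v = row_vec_mult (drawn_start q) (B ^\<^sub>m s)"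
  have v: "is_distribution v" unfolding v_def by (rule x_dist[OF q1])
  have "balance v = m + q * n" unfolding v_def by (rule bal[OF q1])
  then have qv: "(if r = 1 then balance v else 0) = q" using n1 by (simp add: q_def field_simps)
  have "stationary_distribution P = v"
    unfolding stationary_distribution_def
  proof (rule the_equality)
    show "is_stationary_distribution P v"
      unfolding stat using v play_pattern[OF v] qv by (simp add: P_def v_def)
    fix u assume "is_stationary_distribution P u"
    then have u: "is_distribution u" "row_vec_mult u P = u" by (simp_all add: stat)
    \<comment> \<open>Any stationary \<open>u\<close> is determined by the balance that its plays of
      \<open>A\<close> pass on, so uniqueness reduces to the scalar fixed point equation.\<close>
    let ?q = "if r = 1 then balance u else 0"
    have u_eq: "u = row_vec_mult (drawn_start ?q) (B ^\<^sub>m s)" using u play_pattern[OF u(1)] by (simp add: P_def)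
    have bu: "\<bar>balance u\<bar> \<le> 1"
      using u(1) by (auto simp: is_distribution_def all_less_4 sum_lessThan_4 balance_def abs_le_iff)
    have "?q = q"
    proof (cases "r = 1")
      case True
      then have "balance u = m + balance u * n" using bal[OF bu] u_eq by simp
      then show ?thesis using True n1 by (simp add: q_def field_simps)
    qed (simp add: q_def)
    then show "u = v" using u_eq by (simp add: v_def)
  qed
  then have "pattern_stationary kappa lambda r s = v" by (simp add: pattern_stationary_def P_def B_def)
  moreover have "expected_payoff (row_vec_mult v (game_A ^\<^sub>m u)) game_A = 0" for u
    by (rule expected_payoff_game_A[OF row_vec_mult_carrier[OF pow_carrier_mat[OF game_A_carrier]]])
  moreover have "expected_payoff (row_vec_mult v (game_A ^\<^sub>m r * B ^\<^sub>m t)) B =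
      (q - y) * c * ?Q (Suc (Suc t)) + q * eta * ?Q (Suc t)" for t
  proof -
    have "row_vec_mult v (game_A ^\<^sub>m r * B ^\<^sub>m t) = row_vec_mult (drawn_start q) (B ^\<^sub>m t)"
      using play_pattern[OF v] qv by simp
    moreover have "row_vec_mult (drawn_start q) (B ^\<^sub>m t) \<in> carrier_vec 4"
      by (rule row_vec_mult_carrier[OF pow_carrier_mat[OF Bc]])
    then have "expected_payoff (row_vec_mult (drawn_start q) (B ^\<^sub>m t)) B =
        balance (row_vec_mult (row_vec_mult (drawn_start q) (B ^\<^sub>m t)) B)"
      unfolding B by (rule expected_payoff_transition)
    ultimately show ?thesis
      \<comment> \<open>The payoff of play \<open>t\<close> is the balance after that play, hence
        the index \<open>Suc t\<close>.\<close>
      using x_bal[OF q1, of "Suc t"] row_vec_mult_pow_Suc[OF drawn_start_simps(1) Bc, of q t] by simp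
  qed
  ultimately have "mean_profit kappa lambda r s = 1 / (real r + real s) *
      (\<Sum>t<s. (q - y) * c * ?Q (Suc (Suc t)) + q * eta * ?Q (Suc t))"
    by (simp add: mean_profit_def B_def)
  also have "(\<Sum>t<s. (q - y) * c * ?Q (Suc (Suc t)) + q * eta * ?Q (Suc t)) =
      (q - y) * c * ?H (Suc s) + q * eta * ?H s" (is "?sum s = _")
  proof -
    have "?sum k = (q - y) * c * ?H (Suc k) + q * eta * ?H k" for k
      by (induction k) (simp_all add: step_response_base step_response_Suc algebra_simps)
    then show ?thesis .
  qed
  finally have profit: "mean_profit kappa lambda r s =
      1 / (real r + real s) * ((q - y) * c * ?H (Suc s) + q * eta * ?H s)" .
  have k0: "1 + kappa > 0" "1 + lambda > 0" using pos by auto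
  have "\<bar>kappa - lambda\<bar> < 1 + kappa" "\<bar>1 - lambda\<bar> < 1 + lambda" using pos by (simp_all add: abs_less_iff)
  then have "\<bar>c\<bar> < 1/2" and "\<bar>y\<bar> < 1" using k0 by (simp_all add: c y abs_divide field_simps)
  moreover have "\<bar>y\<bar> * (1 - 2 * c) < 1 + 2 * c"
  proof -
    have "\<bar>y\<bar> * (1 - 2 * c) = \<bar>1 - lambda\<bar> / (1 + kappa)"
    proof -
      have "1 - 2 * c = (1 + lambda) / (1 + kappa)" using k0 by (simp add: c field_simps)
      then show ?thesis using k0 by (simp add: y abs_divide)
    qed
    moreover have "1 + 2 * c = (1 + 2 * kappa - lambda) / (1 + kappa)" using k0 by (simp add: c field_simps)
    \<comment> \<open>For \<open>lambda < 1\<close> this is \<open>0 < kappa\<close>; otherwise it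
      is \<open>lambda < 1 + kappa\<close>.\<close>
    moreover have "\<bar>1 - lambda\<bar> < 1 + 2 * kappa - lambda" using pos by (auto simp: abs_less_iff)
    ultimately show ?thesis using k0 by (simp add: divide_strict_right_mono)
  qed
  ultimately have pos_resp: "0 < ?H (Suc s)" "0 < stationary_response c y s"
    using responses_pos s by blast+
  show ?thesis
  proof (cases "r = 1")
    case True
    then have qn: "q * (1 - n) = m" using n1 by (simp add: q_def)
    have "(1 - n) * ((q - y) * c * ?H (Suc s) + q * eta * ?H s) =
        q * (1 - n) * (c * ?H (Suc s) + eta * ?H s) - (1 - n) * (y * c * ?H (Suc s))"
      by (simp add: algebra_simps)
    also have "\<dots> = - (c * y) * stationary_response c y s"
      unfolding qn unfolding m_def n_def stationary_response_def eta_def[symmetric] by (simp add: algebra_simps)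
    finally have "(q - y) * c * ?H (Suc s) + q * eta * ?H s = stationary_response c y s / (1 - n) * (- (c * y))"
      using n1 by (simp add: field_simps)
    then have "mean_profit kappa lambda r s =
        (1 / (real r + real s) * (stationary_response c y s / (1 - n))) * (- (c * y))"
      unfolding profit by (simp add: mult.assoc)
    moreover have "0 < 1 / (real r + real s) * (stationary_response c y s / (1 - n))"
      using pos_resp n1 s by simp
    ultimately show ?thesis by blast
  next
    case False
    then have "mean_profit kappa lambda r s = (1 / (real r + real s) * ?H (Suc s)) * (- (c * y))"
      unfolding profit by (simp add: q_def)
    moreover have "0 < 1 / (real r + real s) * ?H (Suc s)" using pos_resp s by simp
    ultimately show ?thesis by blast
  qed
qed

theorem theorem10:
  fixes kappa lambda :: real and r s :: nat
  assumes "kappa > 0" and "lambda > 0" and "lambda < 1 + kappa"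
    and "(kappa = lambda \<and> lambda > 0) \<or>
         (kappa > 0 \<and> lambda = 1) \<or>
         (kappa \<in> ratio_grid \<and> lambda \<in> ratio_grid \<and> lambda < 1 + kappa \<and> kappa \<noteq> lambda \<and> lambda \<noteq> 1 \<and>
          (beta kappa lambda)^2 + 4 * (alpha kappa lambda)^3 \<noteq> 0 \<and> kappa * lambda \<noteq> 1)"
    and "r > 0" and "s > 0"
  shows "((kappa < lambda \<and> lambda < 1) \<or> (kappa > lambda \<and> lambda > 1) \<longrightarrow> mean_profit kappa lambda r s > 0) \<and>
         (kappa = lambda \<or> lambda = 1 \<longrightarrow> mean_profit kappa lambda r s = 0) \<and>
         (lambda < min kappa 1 \<or> lambda > max kappa 1 \<longrightarrow> mean_profit kappa lambda r s < 0)"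
proof -
  define c where "c = (kappa - lambda) / (2 * (1 + kappa))"
  define y where "y = (1 - lambda) / (1 + lambda)"
  obtain K where K: "K > 0" "mean_profit kappa lambda r s = K * (- (c * y))"
    using mean_profit_sign[OF assms(1-3,5,6) c_def y_def] by blast
  have c: "0 < c \<longleftrightarrow> lambda < kappa" "c < 0 \<longleftrightarrow> kappa < lambda"
    and y: "0 < y \<longleftrightarrow> lambda < 1" "y < 0 \<longleftrightarrow> 1 < lambda"
    using assms(1,2) by (simp_all add: c_def y_def zero_less_divide_iff divide_less_0_iff)
  have "0 < mean_profit kappa lambda r s \<longleftrightarrow> c * y < 0" "mean_profit kappa lambda r s < 0 \<longleftrightarrow> 0 < c * y"
    using K by (auto simp: zero_less_mult_iff mult_less_0_iff)
  moreover have "mean_profit kappa lambda r s = 0" if "kappa = lambda \<or> lambda = 1"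
    using that by (auto simp: K c_def y_def)
  ultimately show ?thesis
    by (auto simp: mult_less_0_iff zero_less_mult_iff c y)
qed

end
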